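(* Let $p\equiv1\pmod4$ be prime and let $X\subseteq\mathbb F_p$ satisfy $|X|\ge p-\sqrt p/3$. Suppose that $f:X\to\mathbb F_p$ is injective and $\chi(f(x)-f(y))=\chi(x-y)$ for all distinct $x,y\in X$. Then there exist $a,b\in\mathbb F_p$, with $a$ a nonzero square, such that $f(x)=ax+b$ for every $x\in X$.
   Context: $\chi$ denotes the quadratic character of $\mathbb F_p$, extended by $\chi(0)=0$: $\chi(t)=1$ if $t$ is a nonzero square and $\chi(t)=-1$ if $t$ is a nonsquare. *)

theory Defs
  imports "HOL-Analysis.Analysis" "Berlekamp_Zassenhaus.Finite_Field"
begin

(* The prime field with p elements is the library field 'p mod_ring, where the index type 'p has
   class prime_card, i.e. CARD('p) = p is prime. *)

definition nonzero_square :: "'p::prime_card mod_ring \<Rightarrow> bool" where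
  "nonzero_square t \<longleftrightarrow> t \<noteq> 0 \<and> (\<exists>s. t = s\<^sup>2)"

definition quad_char :: "'p::prime_card mod_ring \<Rightarrow> int" where
  "quad_char t = (if t = 0 then 0 else if nonzero_square t then 1 else - 1)"

end

theory Submission
  imports Defs
begin

text \<open>
Put \<open>d = p - |X|\<close>, so that \<open>9 d\<^sup>2 \<le> p\<close>. The hypothesis says that all chords of the graph
of \<open>f\<close> have slopes that are nonzero squares. The proof extends \<open>f\<close> to the whole field,
one point at a time, and then shows that an everywhere defined map with this property is
affine.

For the extension, fix a value \<open>w\<close> that \<open>f\<close> does not take on \<open>X\<close>. A point \<open>z\<close> outside
\<open>X\<close> may be sent to \<open>w\<close> iff no line of nonsquare slope through \<open>(z, w)\<close> meets the graph.
Two facts about the correlation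
\<open>S z = (\<Sum>x\<in>X. quad_char (x - z) * quad_char (f x - w))\<close> provide such a \<open>z\<close>.

The first is spectral (\<open>sum_squares_correlation_ge\<close>). The scalar product of two
different rows of the matrix \<open>quad_char (x - z)\<close> does not depend on the rows, and \<open>f\<close>
preserves the part of it that comes from columns in \<open>X\<close>. Therefore the scalar products
of the rows restricted to columns outside \<open>X\<close> equal those of the image rows restricted
to columns outside \<open>f ` X\<close>, which yields \<open>(\<Sum>z\<in>-X. (S z)\<^sup>2) \<ge> |X|\<^sup>2\<close>. Only \<open>d\<close> terms
are summed, so some \<open>S z\<close> is large.

The second is algebraic (\<open>correlation_alternative\<close>). For nonsquare \<open>m\<close>, the map
\<open>x \<mapsto> f x - m * x\<close> is injective on \<open>X\<close> and omits \<open>d\<close> values. The product of the values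
\<open>t - (w - m * z)\<close> over the omitted \<open>t\<close> is a polynomial in \<open>m\<close> of degree at most \<open>d\<close>
(\<open>missed_zero_polynomial\<close>). Hence either every line of nonsquare slope through \<open>(z, w)\<close>
misses the graph, or at most \<open>d\<close> of them do, and then \<open>|S z| \<le> d + 1\<close>. If the second
case held for all \<open>z\<close>, then \<open>|X|\<^sup>2 \<le> d (d + 1)\<^sup>2\<close>, which is false.

For a map on the whole field, \<open>x \<mapsto> f x - m * x\<close> is a permutation for the \<open>(p + 1) / 2\<close>
values of \<open>m\<close> that are zero or nonsquares. Comparing power sums, which are polynomials
in \<open>m\<close>, gives \<open>(\<Sum>x. f x ^ i * x ^ j) = 0\<close> whenever \<open>i + j \<le> (p - 1) / 2\<close>
(\<open>mixed_moments_vanish\<close>), and this is incompatible with an interpolating polynomial of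
degree at least two (\<open>preserves_quad_char_affine\<close>).
\<close>

(* The plain names refer to univariate polynomials, not to the record fields of abstract algebra. *)
hide_const (open) up_ring.coeff up_ring.monom module.smult

section \<open>Power sums and interpolation over a finite field\<close>

lemma of_nat_CARD_finite_field: "of_nat CARD('a::finite_field) = (0 :: 'a)"
proof -
  have "(\<Sum>x\<in>UNIV. x + 1) = (\<Sum>x\<in>UNIV. x :: 'a)"
    by (rule sum.reindex_bij_witness[of _ "\<lambda>x. x - 1" "\<lambda>x. x + 1"]) auto
  then show ?thesis
    by (simp add: sum.distrib)
qed

lemma finite_field_power_card_minus_1:
  fixes x :: "'a::finite_field"
  assumes "x \<noteq> 0"
  shows "x ^ (CARD('a) - 1) = 1"
proof -
  have "x * x ^ (CARD('a) - 1) = x * 1"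
    using finite_field_power_card_eq_same[of x] power_Suc[of x "CARD('a) - 1"]
    by (simp del: power_Suc)
  then show ?thesis
    using assms by (subst (asm) mult_left_cancel) auto
qed

lemma CARD_finite_field_ge_2: "CARD('a::finite_field) \<ge> 2"
proof -
  have "card {0, 1 :: 'a} \<le> CARD('a)"
    by (rule card_mono) auto
  then show ?thesis by simp
qed

text \<open>
Multiplying the summation variable by \<open>a\<close> multiplies the sum by \<open>a ^ k\<close>. Some nonzero
\<open>a\<close> has \<open>a ^ k \<noteq> 1\<close>, since \<open>X ^ k - 1\<close> has at most \<open>k\<close> roots and there are more than \<open>k\<close>
nonzero elements. For \<open>k = 0\<close> the sum is the order of the field, which is zero in it.
\<close>
lemma sum_powers_finite_field:
  assumes "k < CARD('a::finite_field) - 1"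
  shows "(\<Sum>x\<in>UNIV. x ^ k) = (0 :: 'a)"
proof (cases "k = 0")
  case True
  then show ?thesis
    by (simp add: of_nat_CARD_finite_field)
next
  case False
  define P :: "'a poly" where "P = monom 1 k - 1"
  have degP: "degree P \<le> k"
    unfolding P_def by (rule degree_diff_le) (auto simp: degree_monom_le)
  have "coeff P k = 1"
    using False by (simp add: P_def)
  then have "P \<noteq> 0" by auto
  have "\<exists>a :: 'a. a \<noteq> 0 \<and> a ^ k \<noteq> 1"
  proof (rule ccontr)
    assume "\<not> ?thesis"
    then have "UNIV - {0} \<subseteq> {x. poly P x = 0}"
      by (auto simp: P_def poly_monom)
    then have "card (UNIV - {0 :: 'a}) \<le> card {x. poly P x = 0}"
      by (rule card_mono[rotated]) auto
    also have "\<dots> \<le> k"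
      using card_poly_roots_bound[OF \<open>P \<noteq> 0\<close>] degP by linarith
    finally show False
      using assms by (simp add: card_Diff_singleton)
  qed
  then obtain a :: 'a where a: "a \<noteq> 0" "a ^ k \<noteq> 1" by blast
  have "(\<Sum>x\<in>UNIV. x ^ k) = (\<Sum>x\<in>UNIV. (a * x) ^ k)"
    by (rule sum.reindex_bij_witness[of _ "\<lambda>x. a * x" "\<lambda>x. x / a"]) (use a in auto)
  also have "\<dots> = a ^ k * (\<Sum>x\<in>UNIV. x ^ k)"
    by (simp add: power_mult_distrib sum_distrib_left)
  finally show ?thesis
    using a by simp
qed

text \<open>
Summation over the field reads off the coefficient of \<open>X ^ (q - 1)\<close>. This is how the
vanishing of moments is turned into a statement about the degree of an interpolating
polynomial.
\<close>
lemma sum_poly_finite_field: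
  fixes P :: "'a::finite_field poly"
  assumes "degree P \<le> CARD('a) - 1"
  shows "(\<Sum>x\<in>UNIV. poly P x) = - coeff P (CARD('a) - 1)"
proof -
  let ?n = "CARD('a) - 1"
  have n: "?n > 0" "CARD('a) = Suc ?n"
    using CARD_finite_field_ge_2[where 'a='a] by auto
  have top: "(\<Sum>x\<in>UNIV. x ^ ?n) = (-1 :: 'a)"
  proof -
    have "(\<Sum>x\<in>UNIV. x ^ ?n) = (\<Sum>x\<in>UNIV. 1 - (if x = (0 :: 'a) then 1 else 0 :: 'a))"
      by (rule sum.cong) (use n in \<open>auto simp: finite_field_power_card_minus_1 simp del: One_nat_def\<close>)
    also have "\<dots> = -1"
      by (simp add: sum_subtractf of_nat_CARD_finite_field)
    finally show ?thesis .
  qed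
  have "poly P x = (\<Sum>i\<le>?n. coeff P i * x ^ i)" for x
  proof -
    have "poly P x = (\<Sum>i\<le>degree P. coeff P i * x ^ i)" by (rule poly_altdef)
    also have "\<dots> = (\<Sum>i\<le>?n. coeff P i * x ^ i)"
      by (rule sum.mono_neutral_left) (use assms in \<open>auto simp: coeff_eq_0\<close>)
    finally show ?thesis .
  qed
  then have "(\<Sum>x\<in>UNIV. poly P x) = (\<Sum>i\<le>?n. coeff P i * (\<Sum>x\<in>UNIV. x ^ i))"
    by (simp only: sum_distrib_left) (rule sum.swap)
  also have "\<dots> = (\<Sum>i\<le>?n. if i = ?n then - coeff P i else 0)"
    by (rule sum.cong) (auto simp: top sum_powers_finite_field simp del: One_nat_def)
  finally show ?thesis
    by simp
qed

text \<open>
The polynomial \<open>1 - (X - y) ^ (q - 1)\<close> is the indicator function of \<open>y\<close>.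
\<close>
lemma interpolation_finite_field:
  fixes f :: "'a::finite_field \<Rightarrow> 'a"
  obtains g where "degree g \<le> CARD('a) - 1" "\<And>x. poly g x = f x"
proof
  let ?n = "CARD('a) - 1"
  let ?g = "\<Sum>y\<in>UNIV. smult (f y) (1 - [:-y, 1:] ^ ?n)"
  have n: "?n > 0"
    using CARD_finite_field_ge_2[where 'a='a] by auto
  show "degree ?g \<le> ?n"
  proof (rule degree_sum_le)
    fix y :: 'a
    have "degree (1 - [:-y, 1:] ^ ?n) \<le> ?n"
      by (rule degree_diff_le) (auto simp: degree_linear_power)
    then show "degree (smult (f y) (1 - [:-y, 1:] ^ ?n)) \<le> ?n"
      using degree_smult_le order_trans by blast
  qed auto
  show "poly ?g x = f x" for x
  proof -
    have "poly ?g x = (\<Sum>y\<in>UNIV. if y = x then f y else 0)"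
      unfolding poly_sum
      by (rule sum.cong) (use n in \<open>auto simp: finite_field_power_card_minus_1 simp del: One_nat_def\<close>)
    then show ?thesis by simp
  qed
qed

section \<open>Values omitted by maps that are linear in a parameter\<close>

text \<open>
Both sides have degree at most \<open>q - 1\<close> and agree at all \<open>q\<close> points. The reversed factors
\<open>1 - t X\<close> are used instead of \<open>X - t\<close> because they are units as power series.
\<close>
lemma prod_all_linear_factors:
  "(\<Prod>t\<in>UNIV. [:1, - t :: 'a::finite_field:]) = 1 - monom 1 (CARD('a) - 1)"
  (is "?P = ?Q")
proof (rule poly_eqI_degree[where A = UNIV])
  let ?n = "CARD('a) - 1"
  have n: "?n > 0" "CARD('a) = Suc ?n"
    using CARD_finite_field_ge_2[where 'a='a] by auto
  show "poly ?P x = poly ?Q x" for x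
  proof (cases "x = 0")
    case True
    then show ?thesis
      using n by (simp add: poly_prod poly_monom)
  next
    case False
    then have "poly [:1, - (1 / x):] x = 0"
      by simp
    then have "poly ?P x = 0"
      unfolding poly_prod by (intro prod_zero bexI[of _ "1 / x"]) auto
    then show ?thesis
      using False by (simp add: poly_monom finite_field_power_card_minus_1 del: One_nat_def)
  qed
  \<comment> \<open>The factor for \<open>t = 0\<close> is constant, which brings the degree down to \<open>q - 1\<close>.\<close>
  have "degree ?P \<le> sum (degree \<circ> (\<lambda>t :: 'a. [:1, - t:])) UNIV"
    by (rule degree_prod_sum_le) simp
  also have "\<dots> \<le> (\<Sum>t\<in>UNIV. if t = (0 :: 'a) then 0 else 1)"
    by (rule sum_mono) auto
  also have "\<dots> = ?n"
    by (simp add: sum.If_cases Collect_neg_eq[symmetric] card_Diff_singleton Compl_eq_Diff_UNIV)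
  finally show "degree ?P < CARD('a)"
    using n by simp
  have "degree ?Q \<le> ?n"
    by (rule degree_diff_le) (auto simp: degree_monom_le)
  then show "degree ?Q < CARD('a)"
    using n by simp
qed

lemma prod_linear_factors_coeff_card:
  assumes "finite M"
  shows "coeff (\<Prod>t\<in>M. [:1, - t:]) (card M) = (\<Prod>t\<in>M. - t :: 'a::comm_ring_1)"
    and "degree (\<Prod>t\<in>M. [:1, - t:]) \<le> card M"
  using assms
proof (induction M)
  case (insert t M)
  {
    case 1
    show ?case
      using insert by (simp add: coeff_eq_0)
  next
    case 2
    have "degree ([:1, - t:] * (\<Prod>t\<in>M. [:1, - t:])) \<le> 1 + card M"
      by (rule order_trans[OF degree_mult_le add_mono]) (use insert in auto)
    then show ?case
      using insert by simp
  }
qed auto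

lemma geometric_fps_inverse:
  "fps_of_poly [:1, - c:] * Abs_fps (\<lambda>k. c ^ k) = (1 :: 'a::comm_ring_1 fps)"
proof (rule fps_ext)
  fix n
  have eq: "fps_of_poly [:1, - c:] = 1 - fps_const c * fps_X"
    by (simp add: fps_of_poly_pCons fps_of_poly_const mult.commute)
  show "fps_nth (fps_of_poly [:1, - c:] * Abs_fps (\<lambda>k. c ^ k)) n = fps_nth (1 :: 'a fps) n"
    unfolding eq left_diff_distrib mult.assoc by (cases n) simp_all
qed

lemma degree_geometric_product_nth:
  fixes c :: "'b \<Rightarrow> 'a::comm_ring_1 poly"
  assumes "finite X" and "\<And>x. x \<in> X \<Longrightarrow> degree (c x) \<le> 1"
  shows "degree (fps_nth (\<Prod>x\<in>X. Abs_fps (\<lambda>k. c x ^ k)) n) \<le> n"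
  using assms
proof (induction X arbitrary: n)
  case (insert x X)
  have "degree (c x ^ i * fps_nth (\<Prod>x\<in>X. Abs_fps (\<lambda>k. c x ^ k)) (n - i)) \<le> n" if "i \<le> n" for i
  proof -
    have "degree (c x ^ i) \<le> degree (c x) * i"
      by (rule degree_power_le)
    also have "\<dots> \<le> i"
      using insert.prems[of x] by (cases "degree (c x)") auto
    finally have "degree (c x ^ i * fps_nth (\<Prod>x\<in>X. Abs_fps (\<lambda>k. c x ^ k)) (n - i)) \<le> i + (n - i)"
      by (intro order_trans[OF degree_mult_le add_mono] insert.IH insert.prems) auto
    then show ?thesis
      using that by simp
  qed
  then have "degree (\<Sum>i=0..n. c x ^ i * fps_nth (\<Prod>x\<in>X. Abs_fps (\<lambda>k. c x ^ k)) (n - i)) \<le> n"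
    by (intro degree_sum_le) simp_all
  then show ?case
    using insert.hyps by (simp add: fps_mult_nth)
qed auto

text \<open>
The coefficients of \<open>\<Prod> 1 / (1 - c X)\<close> are the complete homogeneous symmetric
functions of the \<open>c\<close>. Keeping the \<open>c\<close> polynomial in a parameter \<open>m\<close> shows that these
coefficients are polynomials in \<open>m\<close>, whose degree is bounded by the previous lemma.
\<close>
lemma poly_geometric_product_nth:
  fixes c :: "'b \<Rightarrow> 'a::comm_ring_1 poly"
  assumes "finite X"
  shows "poly (fps_nth (\<Prod>x\<in>X. Abs_fps (\<lambda>k. c x ^ k)) n) m = fps_nth (\<Prod>x\<in>X. Abs_fps (\<lambda>k. poly (c x) m ^ k)) n"
  using assms
  by (induction X arbitrary: n) (auto simp: fps_mult_nth poly_sum)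

text \<open>
If \<open>x \<mapsto> u x - m * v x\<close> is injective on \<open>X\<close>, then it omits exactly \<open>d = q - |X|\<close> values,
and it omits zero iff the product of the omitted values is zero. That product is, up to
sign, the elementary symmetric function of degree \<open>d\<close> in the omitted values. Since the
product of \<open>1 - t X\<close> over all \<open>t\<close> is \<open>1 - X ^ (q - 1)\<close>, it equals the complete
homogeneous symmetric function of degree \<open>d < q - 1\<close> in the attained values, which is a
polynomial in \<open>m\<close> of degree at most \<open>d\<close>. That one polynomial serves all \<open>m\<close> makes it
possible to count the \<open>m\<close> for which zero is omitted.
\<close>
lemma missed_zero_polynomial:
  fixes u v :: "'a::finite_field \<Rightarrow> 'a"
  assumes "card X > 1"
  obtains P where "degree P \<le> CARD('a) - card X"
    and "\<And>m. inj_on (\<lambda>x. u x - m * v x) X \<Longrightarrow> poly P m = 0 \<longleftrightarrow> (\<forall>x\<in>X. u x \<noteq> m * v x)"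
proof
  let ?d = "CARD('a) - card X"
  let ?c = "\<lambda>x. [:u x, - v x:]"
  let ?P = "fps_nth (\<Prod>x\<in>X. Abs_fps (\<lambda>k. ?c x ^ k)) ?d"
  show "degree ?P \<le> ?d"
    by (rule degree_geometric_product_nth) auto
  fix m
  let ?a = "\<lambda>x. u x - m * v x"
  assume inj: "inj_on ?a X"
  define G where "G = (\<Prod>x\<in>X. Abs_fps (\<lambda>k. ?a x ^ k))"
  define M where "M = - (?a ` X)"
  have cardM: "card M = ?d"
    unfolding M_def using inj by (simp add: Compl_eq_Diff_UNIV card_Diff_subset card_image)
  have d: "?d < CARD('a) - 1"
    using assms card_mono[of UNIV X] by auto
  have "poly ?P m = fps_nth G ?d"
    unfolding G_def by (subst poly_geometric_product_nth) (simp_all add: mult.commute)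
  also have "\<dots> = fps_nth (fps_of_poly (\<Prod>t\<in>UNIV. [:1, - t:]) * G) ?d"
    using d by (simp add: prod_all_linear_factors fps_of_poly_diff fps_of_poly_monom' left_diff_distrib
        fps_X_power_mult_nth)
  also have "fps_of_poly (\<Prod>t\<in>UNIV. [:1, - t:]) * G = fps_of_poly (\<Prod>t\<in>M. [:1, - t:])"
  proof -
    have "(\<Prod>t\<in>UNIV. [:1, - t:]) = (\<Prod>t\<in>M. [:1, - t:]) * (\<Prod>t\<in>?a ` X. [:1, - t:])"
      by (subst prod.union_disjoint[symmetric]) (auto simp: M_def intro!: prod.cong)
    also have "(\<Prod>t\<in>?a ` X. [:1, - t:]) = (\<Prod>x\<in>X. [:1, - ?a x:])"
      by (subst prod.reindex[OF inj]) simp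
    finally have "fps_of_poly (\<Prod>t\<in>UNIV. [:1, - t:]) * G
        = fps_of_poly (\<Prod>t\<in>M. [:1, - t:]) * (\<Prod>x\<in>X. fps_of_poly [:1, - ?a x:] * Abs_fps (\<lambda>k. ?a x ^ k))"
      by (simp only: G_def fps_of_poly_mult fps_of_poly_prod prod.distrib mult.assoc)
    then show ?thesis
      by (simp only: geometric_fps_inverse prod.neutral_const mult_1_right)
  qed
  also have "fps_nth (fps_of_poly (\<Prod>t\<in>M. [:1, - t:])) ?d = (\<Prod>t\<in>M. - t)"
    using prod_linear_factors_coeff_card(1)[of M] cardM by simp
  finally have "poly ?P m = 0 \<longleftrightarrow> 0 \<in> M"
    by simp
  then show "poly ?P m = 0 \<longleftrightarrow> (\<forall>x\<in>X. u x \<noteq> m * v x)"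
    by (auto simp: M_def)
qed

section \<open>The quadratic character\<close>

lemma quad_char_eq_0_iff [simp]: "quad_char t = 0 \<longleftrightarrow> t = 0"
  by (simp add: quad_char_def)

lemma quad_char_cases: "quad_char t = -1 \<or> quad_char t = 0 \<or> quad_char t = 1"
  by (simp add: quad_char_def)

lemma quad_char_square_eq_1: "t \<noteq> 0 \<Longrightarrow> quad_char t * quad_char t = 1"
  by (simp add: quad_char_def)

lemma quad_char_eq_1_iff: "quad_char t = 1 \<longleftrightarrow> nonzero_square t"
  by (auto simp: quad_char_def nonzero_square_def)

lemma quad_char_zero [simp]: "quad_char 0 = 0"
  by simp

lemma quad_char_one [simp]: "quad_char 1 = 1"
  by (auto simp: quad_char_eq_1_iff nonzero_square_def intro: exI[of _ 1])

lemma two_neq_0_mod_ring: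
  assumes "odd CARD('p::prime_card)"
  shows "(2 :: 'p mod_ring) \<noteq> 0"
proof
  assume "(2 :: 'p mod_ring) = 0"
  then have "CARD('p) dvd 2"
    using of_nat_0_mod_ring_dvd[of 2, where 'a='p] by simp
  with assms have "CARD('p) = 1"
    using prime_nat_iff two_is_prime_nat by (metis even_numeral)
  then show False
    using prime_card[where 'a='p] by simp
qed

text \<open>
Squaring is two-to-one on the nonzero elements.
\<close>
lemma card_nonzero_squares:
  assumes "odd CARD('p::prime_card)"
  shows "2 * card {t :: 'p mod_ring. nonzero_square t} = CARD('p) - 1"
proof -
  let ?U = "UNIV - {0 :: 'p mod_ring}"
  have img: "(\<lambda>s. s\<^sup>2) ` ?U = {t. nonzero_square t}"
    by (auto simp: nonzero_square_def)
  have "CARD('p) - 1 = (\<Sum>s\<in>?U. 1)"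
    by (simp add: card_Diff_singleton)
  also have "\<dots> = (\<Sum>t | nonzero_square t. \<Sum>s | s \<in> ?U \<and> s\<^sup>2 = t. 1)"
    by (subst sum.image_gen[where g = "\<lambda>s. s\<^sup>2"]) (simp_all only: img finite)
  also have "\<dots> = (\<Sum>t | nonzero_square (t :: 'p mod_ring). 2)"
  proof (rule sum.cong)
    fix t :: "'p mod_ring"
    assume "t \<in> {t. nonzero_square t}"
    then obtain r where r: "t = r\<^sup>2" "r \<noteq> 0"
      by (auto simp: nonzero_square_def)
    have "r \<noteq> - r"
    proof
      assume "r = - r"
      then have "2 * r = 0"
        by (metis add.right_inverse mult_2)
      then show False
        using r two_neq_0_mod_ring[OF assms] by simp
    qed
    moreover have "{s. s \<in> ?U \<and> s\<^sup>2 = t} = {r, - r}"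
      using r by (auto simp: power2_eq_iff)
    ultimately show "(\<Sum>s | s \<in> ?U \<and> s\<^sup>2 = t. 1) = 2"
      by simp
  qed simp
  finally show ?thesis
    by simp
qed

lemma card_nonsquares:
  assumes "odd CARD('p::prime_card)"
  shows "2 * card {t :: 'p mod_ring. quad_char t = -1} = CARD('p) - 1"
proof -
  have "{t :: 'p mod_ring. quad_char t = -1} = (UNIV - {0}) - {t. nonzero_square t}"
    by (auto simp: quad_char_def)
  then have "card {t :: 'p mod_ring. quad_char t = -1} = (CARD('p) - 1) - card {t :: 'p mod_ring. nonzero_square t}"
    by (simp add: card_Diff_subset card_Diff_singleton nonzero_square_def subset_iff)
  then show ?thesis
    using card_nonzero_squares[OF assms] by simp
qed

lemma nonzero_square_mult_iff:
  assumes "nonzero_square a"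
  shows "nonzero_square (a * b) \<longleftrightarrow> nonzero_square b"
proof
  from assms obtain r where r: "a = r\<^sup>2" "r \<noteq> 0"
    by (auto simp: nonzero_square_def)
  show "nonzero_square b" if "nonzero_square (a * b)"
  proof -
    from that obtain s where "a * b = s\<^sup>2" "a * b \<noteq> 0"
      unfolding nonzero_square_def by blast
    then have "b = (s / r)\<^sup>2" "b \<noteq> 0"
      using r by (auto simp: power_divide field_simps)
    then show ?thesis
      by (auto simp: nonzero_square_def)
  qed
  show "nonzero_square (a * b)" if "nonzero_square b"
    using that assms by (auto simp: nonzero_square_def power_mult_distrib[symmetric])
qed

text \<open>
Only the product of two nonsquares needs an argument. Multiplication by a nonsquare \<open>a\<close>
maps the nonzero squares into the nonsquares, and both sets have \<open>(p - 1) / 2\<close> elements,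
so every nonsquare \<open>b\<close> is \<open>a\<close> times a square.
\<close>
lemma quad_char_mult:
  assumes "odd CARD('p::prime_card)"
  shows "quad_char (a * b :: 'p mod_ring) = quad_char a * quad_char b"
proof -
  consider "a = 0 \<or> b = 0" | "nonzero_square a" | "nonzero_square b"
    | "quad_char a = -1" "quad_char b = -1"
    unfolding quad_char_def by metis
  then show ?thesis
  proof cases
    case 1
    then show ?thesis by (auto simp: quad_char_def)
  next
    case 2
    then show ?thesis
      by (auto simp: quad_char_def nonzero_square_mult_iff)
  next
    case 3
    then show ?thesis
      by (subst mult.commute)
        (auto simp: quad_char_def nonzero_square_mult_iff)
  next
    case 4
    let ?S = "{t :: 'p mod_ring. nonzero_square t}" and ?N = "{t :: 'p mod_ring. quad_char t = -1}"
    have a: "a \<noteq> 0" "\<not> nonzero_square a"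
      using 4 by (auto simp: quad_char_def split: if_splits)
    have "(*) a ` ?S \<subseteq> ?N"
      using a by (auto simp: quad_char_def mult.commute[of a] nonzero_square_mult_iff)
    moreover have "card ((*) a ` ?S) = card ?N"
      using card_nonzero_squares[OF assms] card_nonsquares[OF assms] a
      by (subst card_image) (auto simp: inj_on_def)
    ultimately have "(*) a ` ?S = ?N"
      by (intro card_subset_eq) auto
    then obtain h where h: "b = a * h" "nonzero_square h"
      using 4 by auto
    have "nonzero_square (a\<^sup>2 * h)"
      using a h by (subst nonzero_square_mult_iff) (auto simp: nonzero_square_def)
    then have "nonzero_square (a * b)"
      using h by (simp add: power2_eq_square mult.assoc)
    then show ?thesis
      using 4 by (simp add: quad_char_eq_1_iff)
  qed
qed

lemma quad_char_minus:
  assumes "odd CARD('p::prime_card)"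
  shows "quad_char (- a :: 'p mod_ring) = quad_char (-1 :: 'p mod_ring) * quad_char a"
  using quad_char_mult[OF assms, of "-1" a] by simp

text \<open>
Substituting \<open>z = y - a t\<close> with \<open>a = y' - y\<close> gives every summand a factor
\<open>(quad_char a)\<^sup>2 = 1\<close>. The right-hand side is left unevaluated: what matters is that it
does not depend on \<open>y\<close> and \<open>y'\<close>.
\<close>
lemma quad_char_correlation:
  fixes y y' :: "'p::prime_card mod_ring"
  assumes odd: "odd CARD('p)" and "y \<noteq> y'"
  shows "(\<Sum>z\<in>UNIV. quad_char (y - z) * quad_char (y' - z))
       = (\<Sum>t\<in>UNIV. quad_char t * quad_char (t + 1 :: 'p mod_ring))"
proof -
  define a where "a = y' - y"
  have a: "a \<noteq> 0" "y' = y + a"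
    using assms by (auto simp: a_def)
  have "(\<Sum>z\<in>UNIV. quad_char (y - z) * quad_char (y' - z))
      = (\<Sum>t\<in>UNIV. quad_char (a * t) * quad_char (a * (t + 1)))"
    by (rule sum.reindex_bij_witness[of _ "\<lambda>t. y - a * t" "\<lambda>z. (y - z) / a"])
      (use a in \<open>auto simp: field_simps\<close>)
  also have "\<dots> = (\<Sum>t\<in>UNIV. (quad_char a * quad_char a) * (quad_char t * quad_char (t + 1 :: 'p mod_ring)))"
    by (simp add: quad_char_mult[OF odd] mult_ac)
  also have "\<dots> = (\<Sum>t\<in>UNIV. quad_char t * quad_char (t + 1 :: 'p mod_ring))"
    by (simp add: quad_char_square_eq_1[OF a(1)])
  finally show ?thesis .
qed

section \<open>Maps that preserve the quadratic character of differences\<close>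

definition preserves_quad_char :: "'p::prime_card mod_ring set \<Rightarrow> ('p mod_ring \<Rightarrow> 'p mod_ring) \<Rightarrow> bool" where
  "preserves_quad_char X f \<longleftrightarrow> (\<forall>x\<in>X. \<forall>y\<in>X. quad_char (f x - f y) = quad_char (x - y))"

lemma preserves_quad_charD:
  "preserves_quad_char X f \<Longrightarrow> x \<in> X \<Longrightarrow> y \<in> X \<Longrightarrow> quad_char (f x - f y) = quad_char (x - y)"
  by (auto simp: preserves_quad_char_def)

lemma preserves_quad_char_inj_on:
  assumes "preserves_quad_char X f"
  shows "inj_on f X"
proof (rule inj_onI)
  fix x y
  assume "x \<in> X" "y \<in> X" "f x = f y"
  then have "quad_char (x - y) = 0"
    using preserves_quad_charD[OF assms, of x y] by (simp add: quad_char_def)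
  then show "x = y" by simp
qed

text \<open>
The slopes of chords of the graph of \<open>f\<close> are nonzero squares, so a line whose slope is
zero or a nonsquare meets the graph at most once.
\<close>
lemma inj_on_diff_mult:
  fixes f :: "'p::prime_card mod_ring \<Rightarrow> 'p mod_ring"
  assumes odd: "odd CARD('p)" and f: "preserves_quad_char X f" and "quad_char m \<noteq> 1"
  shows "inj_on (\<lambda>x. f x - m * x) X"
proof (rule inj_onI)
  fix x y
  assume xy: "x \<in> X" "y \<in> X" "f x - m * x = f y - m * y"
  then have "f x - f y = m * (x - y)"
    by (simp add: algebra_simps)
  then have "quad_char (x - y) = quad_char m * quad_char (x - y)"
    using preserves_quad_charD[OF f xy(1,2)] quad_char_mult[OF odd] by metis
  then show "x = y"
    using assms(3) by auto
qed

section \<open>Adding one point to the domain\<close>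

text \<open>
The sum over the whole field depends only on whether \<open>x = y\<close>, and the part of it over
\<open>X\<close> is carried by \<open>f\<close> to the part over \<open>f ` X\<close>; hence the remaining parts agree as well.
In matrix terms: if \<open>B\<close> and \<open>B'\<close> are the blocks of the character matrix with columns
outside \<open>X\<close> and outside \<open>f ` X\<close>, then \<open>B B\<^sup>T = B' B'\<^sup>T\<close>.
\<close>
lemma complement_gram_eq:
  fixes f :: "'p::prime_card mod_ring \<Rightarrow> 'p mod_ring"
  assumes odd: "odd CARD('p)" and f: "preserves_quad_char X f" and xy: "x \<in> X" "y \<in> X"
  shows "(\<Sum>z\<in>-X. quad_char (x - z) * quad_char (y - z))
       = (\<Sum>w\<in>-f ` X. quad_char (f x - w) * quad_char (f y - w))"
proof -
  have split: "(\<Sum>z\<in>-A. g z) = (\<Sum>z\<in>UNIV. g z) - (\<Sum>z\<in>A. g z)"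
    for A and g :: "'p mod_ring \<Rightarrow> int"
    by (simp add: Compl_eq_Diff_UNIV sum_diff)
  have inj: "inj_on f X"
    using f by (rule preserves_quad_char_inj_on)
  have total: "(\<Sum>z\<in>UNIV. quad_char (x - z) * quad_char (y - z))
      = (\<Sum>z\<in>UNIV. quad_char (f x - z) * quad_char (f y - z))"
  proof (cases "x = y")
    case True
    have "(\<Sum>z\<in>UNIV. quad_char (x - z) * quad_char (x - z))
        = (\<Sum>z\<in>UNIV. quad_char (f x - z) * quad_char (f x - z))"
      by (rule sum.reindex_bij_witness[of _ "\<lambda>z. z - f x + x" "\<lambda>z. z + f x - x"]) auto
    then show ?thesis
      using True by simp
  next
    case False
    moreover have "f x \<noteq> f y"
      using False inj xy by (auto dest: inj_onD)
    ultimately show ?thesis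
      by (simp add: quad_char_correlation[OF odd])
  qed
  have "(\<Sum>w\<in>f ` X. quad_char (f x - w) * quad_char (f y - w))
      = (\<Sum>z\<in>X. quad_char (x - z) * quad_char (y - z))"
    using xy by (simp add: sum.reindex[OF inj] preserves_quad_charD[OF f])
  then show ?thesis
    by (simp add: split total)
qed

text \<open>
By the equality of Gram matrices, the vector \<open>b = (quad_char (f x - w))\<^sub>x\<close> has the same
total squared inner product with the columns belonging to points outside \<open>X\<close> as with
those belonging to points outside \<open>f ` X\<close>. Among the latter is \<open>b\<close> itself, and \<open>b\<close> has
squared norm \<open>|X|\<close>.
\<close>
lemma sum_squares_correlation_ge:
  fixes f :: "'p::prime_card mod_ring \<Rightarrow> 'p mod_ring"
  assumes odd: "odd CARD('p)" and f: "preserves_quad_char X f" and w: "w \<notin> f ` X"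
  shows "(int (card X))\<^sup>2 \<le> (\<Sum>z\<in>-X. (\<Sum>x\<in>X. quad_char (x - z) * quad_char (f x - w))\<^sup>2)"
proof -
  let ?b = "\<lambda>x. quad_char (f x - w)"
  have expand: "(\<Sum>z\<in>A. (\<Sum>x\<in>X. h x z * ?b x)\<^sup>2)
      = (\<Sum>x\<in>X. \<Sum>y\<in>X. ?b x * ?b y * (\<Sum>z\<in>A. h x z * h y z))"
    for A and h :: "'p mod_ring \<Rightarrow> 'p mod_ring \<Rightarrow> int"
  proof -
    have "(\<Sum>z\<in>A. (\<Sum>x\<in>X. h x z * ?b x)\<^sup>2)
        = (\<Sum>z\<in>A. \<Sum>x\<in>X. \<Sum>y\<in>X. ?b x * ?b y * (h x z * h y z))"
      by (simp add: power2_eq_square sum_product mult_ac)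
    also have "\<dots> = (\<Sum>x\<in>X. \<Sum>z\<in>A. \<Sum>y\<in>X. ?b x * ?b y * (h x z * h y z))"
      by (rule sum.swap)
    also have "\<dots> = (\<Sum>x\<in>X. \<Sum>y\<in>X. \<Sum>z\<in>A. ?b x * ?b y * (h x z * h y z))"
      by (rule sum.cong[OF refl], rule sum.swap)
    finally show ?thesis
      by (simp add: sum_distrib_left)
  qed
  have "(int (card X))\<^sup>2 = (\<Sum>x\<in>X. ?b x * ?b x)\<^sup>2"
  proof -
    \<comment> \<open>All entries are \<open>\<plusminus>1\<close>, because \<open>w\<close> is not a value of \<open>f\<close> on \<open>X\<close>.\<close>
    have "?b x * ?b x = 1" if "x \<in> X" for x
      using w that by (intro quad_char_square_eq_1) auto
    then show ?thesis by simp
  qed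
  also have "\<dots> \<le> (\<Sum>w'\<in>-f ` X. (\<Sum>x\<in>X. quad_char (f x - w') * ?b x)\<^sup>2)"
    by (rule member_le_sum[where f = "\<lambda>w'. (\<Sum>x\<in>X. quad_char (f x - w') * ?b x)\<^sup>2"])
      (use w in auto)
  also have "\<dots> = (\<Sum>z\<in>-X. (\<Sum>x\<in>X. quad_char (x - z) * ?b x)\<^sup>2)"
    unfolding expand by (intro sum.cong refl) (simp add: complement_gram_eq[OF odd f])
  finally show ?thesis .
qed

text \<open>
Consider the lines through \<open>(z, w)\<close> with nonsquare slope. There are \<open>(p - 1) / 2\<close> of
them, each meets the graph of \<open>f\<close> at most once, and the correlation is \<open>|X|\<close> minus twice
the number of those that meet it. The slopes of those that miss it are zeros of a
polynomial of degree at most \<open>d = p - |X|\<close>. Either this polynomial vanishes, so that all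
of these lines miss the graph and the characters agree on \<open>X\<close>, or at most \<open>d\<close> of the
lines miss it, which puts the correlation between \<open>1 - d\<close> and \<open>d + 1\<close>.
\<close>
lemma correlation_alternative:
  fixes f :: "'p::prime_card mod_ring \<Rightarrow> 'p mod_ring"
  assumes odd: "odd CARD('p)" and f: "preserves_quad_char X f"
    and X: "card X > 1" and z: "z \<notin> X" and w: "w \<notin> f ` X"
  shows "(\<forall>x\<in>X. quad_char (f x - w) = quad_char (x - z))
    \<or> \<bar>\<Sum>x\<in>X. quad_char (x - z) * quad_char (f x - w)\<bar> \<le> int (CARD('p) - card X) + 1"
proof -
  let ?d = "CARD('p) - card X"
  let ?s = "\<lambda>x. (f x - w) / (x - z)"
  define N where "N = {m :: 'p mod_ring. quad_char m = -1}"
  define B where "B = {x \<in> X. quad_char (?s x) = -1}"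
  have nz: "x - z \<noteq> 0" "f x - w \<noteq> 0" if "x \<in> X" for x
    using that z w by auto
  have char_s: "quad_char (?s x) = quad_char (x - z) * quad_char (f x - w)" if "x \<in> X" for x
  proof -
    have "quad_char (f x - w) = quad_char (?s x) * quad_char (x - z)"
      using nz[OF that] by (simp add: quad_char_mult[OF odd, symmetric])
    then show ?thesis
      using quad_char_square_eq_1[OF nz(1)[OF that]] by (simp add: algebra_simps)
  qed
  have inj_line: "inj_on (\<lambda>x. (f x - w) - m * (x - z)) X" if "m \<in> N" for m
  proof -
    have "inj_on (\<lambda>x. f x - m * x) X"
      using inj_on_diff_mult[OF odd f] that by (simp add: N_def)
    then show ?thesis
      by (auto simp: inj_on_def algebra_simps)
  qed
  have injB: "inj_on ?s B"
  proof (rule inj_onI)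
    fix x y
    assume xy: "x \<in> B" "y \<in> B" "?s x = ?s y"
    then have "x \<in> X" "y \<in> X" "?s x \<in> N"
      by (auto simp: B_def N_def)
    moreover have "(f x - w) - ?s x * (x - z) = 0"
      using nz(1)[OF \<open>x \<in> X\<close>] by simp
    moreover have "(f y - w) - ?s x * (y - z) = 0"
      unfolding xy(3) using nz(1)[OF \<open>y \<in> X\<close>] by simp
    ultimately show "x = y"
      using inj_onD[OF inj_line[of "?s x"], of x y] by metis
  qed
  have sN: "?s ` B \<subseteq> N"
    by (auto simp: B_def N_def)
  obtain P where degP: "degree P \<le> ?d"
    and P: "\<And>m. inj_on (\<lambda>x. (f x - w) - m * (x - z)) X \<Longrightarrow>
        poly P m = 0 \<longleftrightarrow> (\<forall>x\<in>X. f x - w \<noteq> m * (x - z))"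
    using missed_zero_polynomial[OF X, of "\<lambda>x. f x - w" "\<lambda>x. x - z"] by auto
  have P_iff: "poly P m = 0 \<longleftrightarrow> m \<notin> ?s ` B" if "m \<in> N" for m
  proof -
    have "m \<in> ?s ` B \<longleftrightarrow> (\<exists>x\<in>X. f x - w = m * (x - z))"
    proof
      assume "m \<in> ?s ` B"
      then obtain x where x: "x \<in> X" "m = ?s x"
        by (auto simp: B_def)
      then have "f x - w = m * (x - z)"
        using nz(1) by simp
      then show "\<exists>x\<in>X. f x - w = m * (x - z)"
        using x(1) by blast
    next
      assume "\<exists>x\<in>X. f x - w = m * (x - z)"
      then obtain x where x: "x \<in> X" "f x - w = m * (x - z)" by blast
      then have "?s x = m"
        using nz(1) by simp
      then show "m \<in> ?s ` B"
        using x(1) that by (force simp: B_def N_def)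
    qed
    then show ?thesis
      using P[OF inj_line[OF that]] by blast
  qed
  \<comment> \<open>The summand at \<open>x\<close> is the character of the slope of the line through \<open>(z, w)\<close> and \<open>(x, f x)\<close>.\<close>
  have corr: "(\<Sum>x\<in>X. quad_char (x - z) * quad_char (f x - w)) = int (card X) - 2 * int (card B)"
  proof -
    have "(\<Sum>x\<in>X. quad_char (x - z) * quad_char (f x - w)) = (\<Sum>x\<in>X. if x \<in> B then - 1 else 1)"
    proof (rule sum.cong)
      fix x assume x: "x \<in> X"
      have "?s x \<noteq> 0" using nz[OF x] by simp
      then have "quad_char (?s x) = (if x \<in> B then - 1 else 1)"
        using x quad_char_cases[of "?s x"] by (auto simp: B_def)
      then show "quad_char (x - z) * quad_char (f x - w) = (if x \<in> B then - 1 else 1)"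
        using char_s[OF x] by simp
    qed simp
    also have "\<dots> = (\<Sum>x\<in>X. 1 - (if x \<in> B then 2 else 0))"
      by (rule sum.cong) auto
    also have "\<dots> = int (card X) - 2 * int (card (X \<inter> B))"
      by (simp add: sum_subtractf sum.If_cases)
    also have "X \<inter> B = B"
      by (auto simp: B_def)
    finally show ?thesis .
  qed
  have cardN: "2 * card N = CARD('p) - 1"
    unfolding N_def by (rule card_nonsquares[OF odd])
  have cardX: "card X \<le> CARD('p)"
    using card_mono[of UNIV X] by simp
  show ?thesis
  proof (cases "P = 0")
    case True
    then have "N \<inter> ?s ` B = {}"
      using P_iff by auto
    then have "B = {}"
      using sN by auto
    have "quad_char (f x - w) = quad_char (x - z)" if x: "x \<in> X" for x
    proof -
      have "quad_char (?s x) \<noteq> -1"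
        using x \<open>B = {}\<close> by (auto simp: B_def)
      then have "quad_char (x - z) * quad_char (f x - w) \<noteq> -1"
        using char_s[OF x] by simp
      moreover have "quad_char (x - z) \<noteq> 0" "quad_char (f x - w) \<noteq> 0"
        using nz[OF x] by simp_all
      ultimately show ?thesis
        using quad_char_cases[of "x - z"] quad_char_cases[of "f x - w"] by auto
    qed
    then show ?thesis by blast
  next
    case False
    have "card (N - ?s ` B) \<le> card {m. poly P m = 0}"
      by (rule card_mono) (use P_iff in auto)
    also have "\<dots> \<le> ?d"
      using card_poly_roots_bound[OF False] degP by linarith
    finally have "card N - card B \<le> ?d"
      using sN by (simp add: card_Diff_subset card_image[OF injB])
    moreover have "card B \<le> card N"
      using card_mono[OF _ sN] card_image[OF injB] by simp
    ultimately show ?thesis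
      using cardN cardX X unfolding corr by (auto simp: of_nat_diff)
  qed
qed

text \<open>
Take any \<open>w\<close> outside the image and set \<open>d = p - |X|\<close>. If no \<open>z\<close> outside \<open>X\<close> were
suitable, then all \<open>d\<close> correlations would be at most \<open>d + 1\<close> in absolute value, whence
\<open>|X|\<^sup>2 \<le> d (d + 1)\<^sup>2\<close>. But \<open>|X| = p - d\<close> is at least \<open>9 d\<^sup>2 - d \<ge> 8 d\<^sup>2\<close>, and
\<open>64 d ^ 4 \<le> d (2 d)\<^sup>2\<close> is impossible.
\<close>
lemma extend_by_one_point:
  fixes f :: "'p::prime_card mod_ring \<Rightarrow> 'p mod_ring"
  assumes odd: "odd CARD('p)" and f: "preserves_quad_char X f" and X: "X \<noteq> UNIV"
    and small: "9 * (CARD('p) - card X)\<^sup>2 \<le> CARD('p)"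
  obtains z w where "z \<notin> X" "preserves_quad_char (insert z X) (f(z := w))"
proof -
  define d where "d = CARD('p) - card X"
  have "X \<subset> UNIV"
    using X by blast
  then have "card X < CARD('p)"
    using psubset_card_mono[of UNIV X] by simp
  then have d: "d \<ge> 1" "card X + d = CARD('p)" "card (- X) = d"
    by (auto simp: d_def Compl_eq_Diff_UNIV card_Diff_subset)
  have "d \<le> d\<^sup>2" "1 \<le> d\<^sup>2"
    using d(1) by (auto simp: power2_eq_square)
  then have ge: "8 * d\<^sup>2 \<le> card X"
    using small d unfolding d_def[symmetric] by linarith
  then have X1: "card X > 1"
    using \<open>1 \<le> d\<^sup>2\<close> by linarith
  have "card (f ` X) < CARD('p)"
    using card_image_le[of X f] d by simp
  then have "f ` X \<noteq> UNIV"
    by auto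
  then obtain w where w: "w \<notin> f ` X"
    by auto
  let ?S = "\<lambda>z. \<Sum>x\<in>X. quad_char (x - z) * quad_char (f x - w)"
  have "\<exists>z. z \<notin> X \<and> (\<forall>x\<in>X. quad_char (f x - w) = quad_char (x - z))"
  proof (rule ccontr)
    assume none: "\<not> ?thesis"
    have "(int (card X))\<^sup>2 \<le> (\<Sum>z\<in>-X. (?S z)\<^sup>2)"
      by (rule sum_squares_correlation_ge[OF odd f w])
    also have "\<dots> \<le> (\<Sum>z\<in>-X. (int d + 1)\<^sup>2)"
    proof (rule sum_mono)
      fix z assume "z \<in> - X"
      then have "\<bar>?S z\<bar> \<le> int d + 1"
        using correlation_alternative[OF odd f X1 _ w, of z] none by (auto simp: d_def)
      then show "(?S z)\<^sup>2 \<le> (int d + 1)\<^sup>2"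
        using abs_le_square_iff[of "?S z" "int d + 1"] by simp
    qed
    also have "\<dots> = int (d * (d + 1)\<^sup>2)"
      using d(3) by simp
    finally have "(card X)\<^sup>2 \<le> d * (d + 1)\<^sup>2"
      by (metis of_nat_le_iff of_nat_power)
    moreover have "(8 * d\<^sup>2)\<^sup>2 \<le> (card X)\<^sup>2"
      using ge by (rule power_mono) simp
    moreover have "d * (d + 1)\<^sup>2 \<le> d * (2 * d)\<^sup>2"
      using d(1) by (intro mult_left_mono power_mono) auto
    ultimately have "(8 * d\<^sup>2)\<^sup>2 \<le> d * (2 * d)\<^sup>2"
      by linarith
    then have "64 * d ^ 4 \<le> 4 * d ^ 3"
      by (simp add: power_mult_distrib power4_eq_xxxx power3_eq_cube power2_eq_square mult_ac)
    moreover have "d ^ 3 \<le> d ^ 4" "d ^ 3 \<ge> 1"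
      using d(1) by (auto intro: power_increasing)
    ultimately show False
      by linarith
  qed
  then obtain z where z: "z \<notin> X" and zw: "\<And>x. x \<in> X \<Longrightarrow> quad_char (f x - w) = quad_char (x - z)"
    by blast
  have zw': "quad_char (w - f x) = quad_char (z - x)" if "x \<in> X" for x
    using zw[OF that] quad_char_minus[OF odd, of "f x - w"] quad_char_minus[OF odd, of "x - z"]
    by simp
  have "preserves_quad_char (insert z X) (f(z := w))"
    using f z zw zw' by (auto simp: preserves_quad_char_def)
  then show ?thesis
    using that z by blast
qed

lemma extend_to_field:
  fixes f :: "'p::prime_card mod_ring \<Rightarrow> 'p mod_ring"
  assumes odd: "odd CARD('p)" and "preserves_quad_char X f"
    and "9 * (CARD('p) - card X)\<^sup>2 \<le> CARD('p)"
  obtains g where "preserves_quad_char UNIV g" "\<And>x. x \<in> X \<Longrightarrow> g x = f x"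
proof -
  have "\<exists>g. preserves_quad_char UNIV g \<and> (\<forall>x\<in>X. g x = f x)"
    using assms(2,3)
  proof (induction "card (- X)" arbitrary: X f)
    case 0
    then have "X = UNIV" by auto
    then show ?case using 0 by auto
  next
    case (Suc n)
    then have "X \<noteq> UNIV" by auto
    then obtain z w where zw: "z \<notin> X" "preserves_quad_char (insert z X) (f(z := w))"
      using extend_by_one_point[OF odd Suc.prems(1) _ Suc.prems(2)] by blast
    have "- insert z X = - X - {z}" by auto
    then have "n = card (- insert z X)"
      using Suc.hyps(2) zw(1) by simp
    moreover have "9 * (CARD('p) - card (insert z X))\<^sup>2 \<le> CARD('p)"
    proof -
      have "(CARD('p) - card (insert z X))\<^sup>2 \<le> (CARD('p) - card X)\<^sup>2"
        using zw(1) by (intro power_mono) auto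
      then show ?thesis
        using Suc.prems(2) by linarith
    qed
    ultimately obtain g where "preserves_quad_char UNIV g"
      "\<forall>x\<in>insert z X. g x = (f(z := w)) x"
      using Suc.hyps(1)[OF _ zw(2)] by blast
    then show ?case
      using zw(1) by (intro exI[of _ g]) auto
  qed
  then show ?thesis
    using that by blast
qed

section \<open>Maps defined on the whole field\<close>

lemma of_nat_binomial_neq_0:
  assumes "k < CARD('p::prime_card)" "i \<le> k"
  shows "of_nat (k choose i) \<noteq> (0 :: 'p mod_ring)"
proof
  assume "of_nat (k choose i) = (0 :: 'p mod_ring)"
  then have "CARD('p) dvd (k choose i)"
    by (rule of_nat_0_mod_ring_dvd)
  then have "CARD('p) dvd fact k"
    using binomial_fact_lemma[OF assms(2)] by (metis dvd_mult)
  then show False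
    using assms(1) prime_card[where 'a='p] by (simp add: prime_dvd_fact_iff)
qed

text \<open>
If \<open>m\<close> is zero or a nonsquare, \<open>x \<mapsto> f x - m * x\<close> is a permutation, so the power sums of
exponent \<open>k = i + j < p - 1\<close> of its values vanish. As a polynomial in \<open>m\<close> such a power
sum has degree at most \<open>k \<le> (p - 1) / 2\<close>, and it has \<open>(p + 1) / 2\<close> zeros, so all its
coefficients vanish. These are the mixed moments, up to signs and binomial coefficients
that are nonzero modulo \<open>p\<close>.
\<close>
lemma mixed_moments_vanish:
  fixes f :: "'p::prime_card mod_ring \<Rightarrow> 'p mod_ring"
  assumes odd: "odd CARD('p)" and big: "CARD('p) > 3" and f: "preserves_quad_char UNIV f"
    and ij: "2 * (i + j) \<le> CARD('p) - 1"
  shows "(\<Sum>x\<in>UNIV. f x ^ i * x ^ j) = 0"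
proof -
  let ?k = "i + j"
  define P where "P = (\<Sum>x\<in>UNIV. [:f x, - x:] ^ ?k)"
  define N where "N = {m :: 'p mod_ring. quad_char m \<noteq> 1}"
  define n where "n = CARD('p) - 1"
  have n: "n \<ge> 3" "2 * ?k \<le> n" "CARD('p) = Suc n"
    using big ij by (auto simp: n_def)
  then have k: "?k < n"
    by simp
  have "insert 0 {m. quad_char m = -1} = N"
    using quad_char_cases by (auto simp: N_def)
  then have "card N = Suc (card {m :: 'p mod_ring. quad_char m = -1})"
    by (subst card_insert_disjoint[symmetric]) auto
  then have cardN: "?k < card N"
    using card_nonsquares[OF odd] n(2) unfolding n_def[symmetric] by simp
  have "P = 0"
  proof (rule poly_eqI_degree[where A = N])
    show "poly P m = poly 0 m" if "m \<in> N" for m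
    proof -
      have "bij (\<lambda>x. f x - m * x)"
        using inj_on_diff_mult[OF odd f, of m] that
        by (simp add: N_def bij_def finite_UNIV_inj_surj)
      then have "(\<Sum>x\<in>UNIV. (f x - m * x) ^ ?k) = (\<Sum>t\<in>UNIV. t ^ ?k)"
        by (rule sum.reindex_bij_betw)
      also have "\<dots> = 0"
        using k n(3) by (intro sum_powers_finite_field) simp
      finally show ?thesis
        by (simp add: P_def poly_sum mult.commute)
    qed
    have "degree P \<le> ?k"
      unfolding P_def
    proof (rule degree_sum_le)
      fix x :: "'p mod_ring"
      have "degree ([:f x, - x:] ^ ?k) \<le> degree [:f x, - x:] * ?k"
        by (rule degree_power_le)
      also have "\<dots> \<le> 1 * ?k"
        by (rule mult_right_mono) auto
      finally show "degree ([:f x, - x:] ^ ?k) \<le> ?k" by simp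
    qed simp
    then show "degree P < card N"
      using cardN by simp
    show "degree (0 :: 'p mod_ring poly) < card N"
      using cardN by simp
  qed
  then have "0 = coeff P j"
    by simp
  also have "\<dots> = (\<Sum>x\<in>UNIV. coeff ([:f x, - x:] ^ ?k) j)"
    unfolding P_def by (rule coeff_sum)
  also have "\<dots> = (\<Sum>x\<in>UNIV. of_nat (?k choose j) * (-1) ^ j * (f x ^ i * x ^ j))"
  proof (rule sum.cong)
    fix x
    show "coeff ([:f x, - x:] ^ ?k) j = of_nat (?k choose j) * (-1) ^ j * (f x ^ i * x ^ j)"
      by (subst coeff_linear_poly_power) (simp_all add: power_minus[of x] mult_ac)
  qed simp
  also have "\<dots> = of_nat (?k choose j) * (-1) ^ j * (\<Sum>x\<in>UNIV. f x ^ i * x ^ j)"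
    by (simp add: sum_distrib_left)
  finally show ?thesis
    using k n(3) of_nat_binomial_neq_0[of ?k j, where 'p='p] by simp
qed

text \<open>
Let \<open>g\<close> interpolate \<open>f\<close>, with \<open>e = degree g\<close>. Whenever \<open>i * e + j = p - 1\<close>, the
polynomial \<open>g ^ i * X ^ j\<close> has degree exactly \<open>p - 1\<close>, so its sum over the field is
nonzero, and the vanishing of the mixed moments forces \<open>2 * (i + j) > p - 1\<close>. For
\<open>e \<ge> 2\<close> this is contradicted: the choice \<open>i = 1\<close> gives \<open>e \<le> (p - 1) / 2\<close>, and then
division of \<open>p - 1\<close> by \<open>e\<close> with remainder gives \<open>i \<ge> 2\<close>, \<open>j < e\<close> and
\<open>2 * (i + j) \<le> p - 1\<close>.
\<close>
lemma preserves_quad_char_affine: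
  fixes f :: "'p::prime_card mod_ring \<Rightarrow> 'p mod_ring"
  assumes odd: "odd CARD('p)" and big: "CARD('p) > 3" and f: "preserves_quad_char UNIV f"
  obtains a b where "nonzero_square a" "\<And>x. f x = a * x + b"
proof -
  define n where "n = CARD('p) - 1"
  obtain g where deg: "degree g \<le> n" and g: "\<And>x. poly g x = f x"
    using interpolation_finite_field[of f] unfolding n_def by auto
  define e where "e = degree g"
  have small: "2 * (i + j) > n" if "i * e + j = n" "g \<noteq> 0" for i j
  proof (rule ccontr)
    assume "\<not> ?thesis"
    then have "(\<Sum>x\<in>UNIV. f x ^ i * x ^ j) = 0"
      by (intro mixed_moments_vanish[OF odd big f]) (simp add: n_def)
    then have "(\<Sum>x\<in>UNIV. poly (g ^ i * monom 1 j) x) = 0"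
      by (simp add: g poly_monom)
    moreover have "degree (g ^ i * monom 1 j) = n"
      using that by (simp add: degree_mult_eq degree_power_eq degree_monom_eq e_def mult.commute)
    ultimately have "lead_coeff (g ^ i * monom 1 j) = 0"
      using sum_poly_finite_field[of "g ^ i * monom 1 j"] by (simp add: n_def)
    then show False
      using that by simp
  qed
  have "e \<le> 1"
  proof (rule ccontr)
    assume "\<not> e \<le> 1"
    then have e: "e \<ge> 2" "g \<noteq> 0"
      by (auto simp: e_def)
    have "2 * (n - e + 1) > n"
      using small[of 1 "n - e"] e deg by (simp add: e_def)
    moreover obtain h where h: "n = 2 * h"
      using odd unfolding n_def by (auto elim: oddE)
    ultimately have eh: "e \<le> h"
      using deg unfolding e_def by simp
    define i j where "i = n div e" and "j = n mod e"
    have ij: "i * e + j = n" "j < e"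
      using e by (auto simp: i_def j_def)
    have i2: "i \<ge> 2"
      unfolding i_def using eh h e(1) by (subst less_eq_div_iff_mult_less_eq) auto
    \<comment> \<open>For \<open>e \<ge> 3\<close> this follows from \<open>j < e\<close>; for \<open>e = 2\<close> the remainder is zero, as \<open>p - 1\<close> is even.\<close>
    have "2 * i + j \<le> i * e"
    proof (cases "e = 2")
      case True
      moreover have "j = 0"
        unfolding j_def True h by simp
      ultimately show ?thesis by simp
    next
      case False
      then have "3 \<le> e"
        using e(1) by linarith
      then obtain e' where "e = 3 + e'"
        by (rule less_eqE)
      moreover obtain i' where "i = 2 + i'"
        using i2 by (rule less_eqE)
      ultimately show ?thesis
        using ij(2) by (simp add: algebra_simps)
    qed
    then show False
      using small[OF ij(1) e(2)] ij(1) unfolding distrib_left by linarith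
  qed
  then have "g = [:coeff g 0, coeff g 1:]"
    by (intro poly_eqI) (auto simp: coeff_pCons e_def coeff_eq_0 split: nat.splits)
  then obtain a b where "g = [:b, a:]" by blast
  then have fab: "f x = a * x + b" for x
    using g[of x] by (simp add: mult.commute add.commute)
  moreover have "quad_char a = 1"
    using preserves_quad_charD[OF f, of 1 0] by (simp add: fab)
  ultimately show ?thesis
    using that by (simp add: quad_char_eq_1_iff)
qed

theorem lemma6p3:
  fixes p :: nat
    and X :: "'p::prime_card mod_ring set"
    and f :: "'p mod_ring \<Rightarrow> 'p mod_ring"
  assumes "CARD('p) = p"
    and "p mod 4 = 1"
    and "real (card X) \<ge> real p - sqrt (real p) / 3"
    and "inj_on f X"
    and "\<And>x y. x \<in> X \<Longrightarrow> y \<in> X \<Longrightarrow> x \<noteq> y \<Longrightarrow>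
           quad_char (f x - f y) = quad_char (x - y)"
  shows "\<exists>a b. nonzero_square a \<and> (\<forall>x\<in>X. f x = a * x + b)"
proof -
  have odd: "odd CARD('p)"
    using assms(1,2) by presburger
  have "CARD('p) \<noteq> 1"
    using prime_card[where 'a='p] by auto
  then have big: "CARD('p) > 3"
    using assms(1,2) by presburger
  have f: "preserves_quad_char X f"
    using assms(5) unfolding preserves_quad_char_def by (metis diff_self)
  have "card X \<le> CARD('p)"
    using card_mono[of UNIV X] by simp
  then have "3 * real (CARD('p) - card X) \<le> sqrt (real CARD('p))"
    using assms(1,3) by (simp add: of_nat_diff)
  then have "(3 * real (CARD('p) - card X))\<^sup>2 \<le> real CARD('p)"
    using power_mono[of "3 * real (CARD('p) - card X)" "sqrt (real CARD('p))" 2] by simp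
  then have "real (9 * (CARD('p) - card X)\<^sup>2) \<le> real CARD('p)"
    by (simp add: power_mult_distrib)
  then have "9 * (CARD('p) - card X)\<^sup>2 \<le> CARD('p)"
    by (simp only: of_nat_le_iff)
  then obtain g where g: "preserves_quad_char UNIV g" "\<And>x. x \<in> X \<Longrightarrow> g x = f x"
    using extend_to_field[OF odd f] by blast
  then obtain a b where "nonzero_square a" "\<And>x. g x = a * x + b"
    using preserves_quad_char_affine[OF odd big g(1)] by blast
  then show ?thesis
    using g(2) by metis
qed

end
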